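(* Let $(s_1,s_2)$ be an arbitrary edge in the cut graph $G_{m_1,m_2,m_3}$ and let $(r_{h1},r_{h2})$ be an arbitrary pair of vertices in $\mathcal{O}_h$ $(h=1,2,\dots,t)$. Then the SDP relaxation $\mathrm{MC}_{\mathrm{fix}}$ dominates $\mathrm{MC}_{\mathrm{QAP}}$; that is, the bound $\mathrm{MC}_{\mathrm{fix}}=\min_{h=1,\dots,t}\mu_h^*$ is greater than or equal to the optimal value of $\mathrm{MC}_{\mathrm{QAP}}$.
   Context: Setting: $G$ is an undirected graph on vertex set $\{1,\dots,n\}$ with adjacency matrix $A=(a_{ij})$; $m_1,m_2,m_3$ are nonnegative integers with $m_1,m_2\ge1$ and $m_1+m_2+m_3=n$. $\mathcal{O}_1,\dots,\mathcal{O}_t$ are the orbitals of edges and nonedges of $G$, i.e. the orbits of the automorphism group of $G$ acting on ordered pairs of distinct vertices. The cut graph $G_{m_1,m_2,m_3}$ is the graph on $\{1,\dots,n\}$ with adjacency matrix $$B=(b_{ij})=\begin{pmatrix} 0_{m_1\times m_1} & J_{m_1\times m_2} & 0_{m_1\times m_3}\\ J_{m_2\times m_1} & 0_{m_2\times m_2} & 0_{m_2\times m_3}\\ 0_{m_3\times m_1} & 0_{m_3\times m_2} & 0_{m_3\times m_3}\end{pmatrix}.$$ Notation: $\mathcal{S}^+_k$ is the set of $k\times k$ real symmetric positive semidefinite matrices; $I$ and $J$ are identity and all-ones matrices; $E_{jj}=e_je_j^{\mathrm T}$; $M(\alpha,\beta)$ is the submatrix of $M$ with rows indexed by $\alpha$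 and columns by $\beta$, and $M(\alpha)=M(\alpha,\alpha)$; $\operatorname{vec}$ stacks the columns of a matrix; $\operatorname{Diag}(c)$ is the diagonal matrix with diagonal $c$; $Y\ge0$ is meant entrywise. $\mathrm{MC}_{\mathrm{QAP}}$ is the semidefinite program: minimize $\frac12\operatorname{tr}\big((B\otimes A)Y\big)$ over $Y\in\mathcal{S}^+_{n^2}$, $Y\ge0$, subject to $\operatorname{tr}\big((I_n\otimes E_{jj})Y\big)=1$, $\operatorname{tr}\big((E_{jj}\otimes I_n)Y\big)=1$ for $j=1,\dots,n$; $\operatorname{tr}\big((I_n\otimes(J_n-I_n)+(J_n-I_n)\otimes I_n)Y\big)=0$; and $\operatorname{tr}(JY)=n^2$. For $h=1,\dots,t$ let $\alpha^h=\{1,\dots,n\}\setminus\{r_{h1},r_{h2}\}$, $\beta=\{1,\dots,n\}\setminus\{s_1,s_2\}$, $$\hat C^h=2A(\alpha^h,r_{h1})B(s_1,\beta)+2A(\alpha^h,r_{h2})B(s_2,\beta),\qquad \hat c^h=\operatorname{vec}(\hat C^h),$$ $$d^h=a_{r_{h1}r_{h1}}b_{s_1s_1}+a_{r_{h2}r_{h2}}b_{s_2s_2}+2a_{r_{h1}r_{h2}}b_{s_1s_2}.$$ Let $\mu_h^*$ be the optimal value of the semidefinite program $\mathrm{MC}^h_{\mathrm{fix}}$: minimize $\frac12\operatorname{tr}\big((B(\beta)\otimes A(\alpha^h)+\operatorname{Diag}(\hat c^h))Y\big)+\frac12d^h$ over $Y\in\mathcal{S}^+_{(n-2)^2}$,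 $Y\ge0$, subject to $\operatorname{tr}\big((I\otimes E_{jj})Y\big)=1$, $\operatorname{tr}\big((E_{jj}\otimes I)Y\big)=1$ for $j=1,\dots,n-2$; $\operatorname{tr}\big((I\otimes(J-I)+(J-I)\otimes I)Y\big)=0$; and $\operatorname{tr}(JY)=(n-2)^2$; where in the first three constraints $I,J,E_{jj}$ have order $n-2$. Finally, $\mathrm{MC}_{\mathrm{fix}}:=\min_{h=1,\dots,t}\mu_h^*$. *)

theory Defs
  imports
    "HOL-Library.Extended_Real"
    "HOL-Algebra.Group_Action"
    "Jordan_Normal_Form.Matrix"
    "Jordan_Normal_Form.DL_Submatrix"
    "Graph_Theory.Pair_Digraph"
begin

section \<open>Matrices\<close>

text \<open>Rows and columns are numbered from \<open>0\<close>, so the vertex set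
  \<open>{1,\<dots>,n}\<close> becomes \<open>{0..<n}\<close>.\<close>

definition all_ones_mat :: "nat \<Rightarrow> nat \<Rightarrow> real mat" (\<open>J\<^sub>m\<close>) where
  "J\<^sub>m r c = mat r c (\<lambda>_. 1)"

definition diag_unit_mat :: "nat \<Rightarrow> nat \<Rightarrow> real mat" (\<open>E\<^sub>m\<close>) where
  "E\<^sub>m k j = mat k k (\<lambda>(a, b). if a = j \<and> b = j then 1 else 0)"

definition mat_trace :: "real mat \<Rightarrow> real" where
  "mat_trace M = (\<Sum>i<dim_row M. M $$ (i, i))"

definition kron :: "real mat \<Rightarrow> real mat \<Rightarrow> real mat" (infixl \<open>\<otimes>\<^sub>m\<close> 70) where
  "P \<otimes>\<^sub>m Q = mat (dim_row P * dim_row Q) (dim_col P * dim_col Q)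
     (\<lambda>(i, j). P $$ (i div dim_row Q, j div dim_col Q) * Q $$ (i mod dim_row Q, j mod dim_col Q))"

text \<open>Column stacking: entry \<open>(i, j)\<close> goes to position \<open>j * dim_row C + i\<close>.\<close>

definition vectorize :: "real mat \<Rightarrow> real vec" where
  "vectorize C = vec (dim_row C * dim_col C) (\<lambda>k. C $$ (k mod dim_row C, k div dim_row C))"

definition diag_of_vec :: "real vec \<Rightarrow> real mat" where
  "diag_of_vec c = mk_diagonal (list_of_vec c)"

definition psd_mats :: "nat \<Rightarrow> real mat set" where
  "psd_mats k = {Y \<in> carrier_mat k k. transpose_mat Y = Y \<and>
     (\<forall>v \<in> carrier_vec k. 0 \<le> v \<bullet> (Y *\<^sub>v v))}"

section \<open>Graphs, orbitals and the cut graph\<close>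

text \<open>Undirected graphs are represented as symmetric loop-free digraphs
  (\<^locale>\<open>pair_graph\<close>), so every edge is present as two arcs.\<close>

definition adj_mat :: "nat \<Rightarrow> nat pair_pre_digraph \<Rightarrow> real mat" where
  "adj_mat n G = mat n n (\<lambda>(i, j). if (i, j) \<in> parcs G then 1 else 0)"

definition aut_group :: "'a pair_pre_digraph \<Rightarrow> ('a \<Rightarrow> 'a) monoid" where
  "aut_group G =
     \<lparr> carrier = {p. p permutes pverts G \<and>
         (\<forall>u \<in> pverts G. \<forall>v \<in> pverts G. (p u, p v) \<in> parcs G \<longleftrightarrow> (u, v) \<in> parcs G)},
       monoid.mult = (\<circ>),
       one = id \<rparr>"

definition orbitals :: "'a pair_pre_digraph \<Rightarrow> ('a \<times> 'a) set set" where
  "orbitals G =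
     orbits (aut_group G) {(u, v). u \<in> pverts G \<and> v \<in> pverts G \<and> u \<noteq> v} (\<lambda>p. map_prod p p)"

definition cut_mat :: "nat \<Rightarrow> nat \<Rightarrow> nat \<Rightarrow> real mat" where
  "cut_mat m1 m2 m3 =
     four_block_mat
       (four_block_mat (0\<^sub>m m1 m1) (J\<^sub>m m1 m2)
                       (J\<^sub>m m2 m1) (0\<^sub>m m2 m2))
       (0\<^sub>m (m1 + m2) m3)
       (0\<^sub>m m3 (m1 + m2))
       (0\<^sub>m m3 m3)"

definition cut_graph :: "nat \<Rightarrow> nat \<Rightarrow> nat \<Rightarrow> nat pair_pre_digraph" where
  "cut_graph m1 m2 m3 =
     \<lparr> pverts = {0..<m1 + m2 + m3},
       parcs = {(u, v). u < m1 + m2 + m3 \<and> v < m1 + m2 + m3 \<and> cut_mat m1 m2 m3 $$ (u, v) = 1} \<rparr>"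

section \<open>The semidefinite programs\<close>

text \<open>The relaxations for order \<open>n\<close> and for order \<open>n - 2\<close> have the same constraints,
  with \<open>k\<close> equal to \<open>n\<close> and \<open>n - 2\<close>, respectively. The order on matrices is entrywise.\<close>

definition qap_feasible :: "nat \<Rightarrow> real mat set" where
  "qap_feasible k = {Y \<in> psd_mats (k\<^sup>2).
     0\<^sub>m (k\<^sup>2) (k\<^sup>2) \<le> Y \<and>
     (\<forall>j<k. mat_trace ((1\<^sub>m k \<otimes>\<^sub>m E\<^sub>m k j) * Y) = 1) \<and>
     (\<forall>j<k. mat_trace ((E\<^sub>m k j \<otimes>\<^sub>m 1\<^sub>m k) * Y) = 1) \<and>
     mat_trace ((1\<^sub>m k \<otimes>\<^sub>m (J\<^sub>m k k - 1\<^sub>m k) + (J\<^sub>m k k - 1\<^sub>m k) \<otimes>\<^sub>m 1\<^sub>m k) * Y) = 0 \<and>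
     mat_trace (J\<^sub>m (k\<^sup>2) (k\<^sup>2) * Y) = real (k\<^sup>2)}"

text \<open>Optimal values are infima in the extended reals: the infimum over an empty feasible
  set is \<open>\<infinity>\<close> and not an arbitrary real number.\<close>

definition MC_QAP :: "nat \<Rightarrow> real mat \<Rightarrow> real mat \<Rightarrow> ereal" where
  "MC_QAP n A B = (INF Y \<in> qap_feasible n. ereal (1/2 * mat_trace ((B \<otimes>\<^sub>m A) * Y)))"

definition fix_C :: "nat \<Rightarrow> real mat \<Rightarrow> real mat \<Rightarrow> nat \<Rightarrow> nat \<Rightarrow> nat \<Rightarrow> nat \<Rightarrow> real mat" where
  "fix_C n A B s1 s2 r1 r2 =
     (let \<alpha> = {0..<n} - {r1, r2}; \<beta> = {0..<n} - {s1, s2} in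
       2 \<cdot>\<^sub>m (submatrix A \<alpha> {r1} * submatrix B {s1} \<beta>) +
       2 \<cdot>\<^sub>m (submatrix A \<alpha> {r2} * submatrix B {s2} \<beta>))"

definition fix_d :: "real mat \<Rightarrow> real mat \<Rightarrow> nat \<Rightarrow> nat \<Rightarrow> nat \<Rightarrow> nat \<Rightarrow> real" where
  "fix_d A B s1 s2 r1 r2 =
     A $$ (r1, r1) * B $$ (s1, s1) + A $$ (r2, r2) * B $$ (s2, s2) +
     2 * A $$ (r1, r2) * B $$ (s1, s2)"

definition MC_fix_pair ::
  "nat \<Rightarrow> real mat \<Rightarrow> real mat \<Rightarrow> nat \<Rightarrow> nat \<Rightarrow> nat \<Rightarrow> nat \<Rightarrow> ereal" where
  "MC_fix_pair n A B s1 s2 r1 r2 =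
     (let \<alpha> = {0..<n} - {r1, r2}; \<beta> = {0..<n} - {s1, s2} in
       INF Y \<in> qap_feasible (n - 2).
         ereal (1/2 * mat_trace
             ((submatrix B \<beta> \<beta> \<otimes>\<^sub>m submatrix A \<alpha> \<alpha> +
               diag_of_vec (vectorize (fix_C n A B s1 s2 r1 r2))) * Y)
           + 1/2 * fix_d A B s1 s2 r1 r2))"

definition MC_fix ::
  "nat \<Rightarrow> real mat \<Rightarrow> real mat \<Rightarrow> nat \<Rightarrow> nat \<Rightarrow> nat \<Rightarrow> (nat \<Rightarrow> nat) \<Rightarrow> (nat \<Rightarrow> nat) \<Rightarrow> ereal" where
  "MC_fix n A B s1 s2 t r1 r2 = Min ((\<lambda>h. MC_fix_pair n A B s1 s2 (r1 h) (r2 h)) ` {1..t})"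

section \<open>Consistency of the encodings\<close>

lemma index_cut_mat:
  assumes "i < m1 + m2 + m3" "j < m1 + m2 + m3"
  shows "cut_mat m1 m2 m3 $$ (i, j) =
    (if (i < m1 \<and> m1 \<le> j \<and> j < m1 + m2) \<or> (j < m1 \<and> m1 \<le> i \<and> i < m1 + m2) then 1 else 0)"
  using assms by (auto simp: cut_mat_def all_ones_mat_def)

lemma pair_graph_cut_graph: "pair_graph (cut_graph m1 m2 m3)"
proof unfold_locales
  show "finite (parcs (cut_graph m1 m2 m3))"
    by (rule finite_subset[of _ "{0..<m1 + m2 + m3} \<times> {0..<m1 + m2 + m3}"])
      (auto simp: cut_graph_def)
  show "symmetric (with_proj (cut_graph m1 m2 m3))"
    by (auto simp: symmetric_def cut_graph_def index_cut_mat intro!: symI split: if_splits)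
qed (auto simp: cut_graph_def index_cut_mat split: if_splits)

lemma adj_mat_cut_graph: "adj_mat (m1 + m2 + m3) (cut_graph m1 m2 m3) = cut_mat m1 m2 m3"
proof (rule eq_matI)
  show "adj_mat (m1 + m2 + m3) (cut_graph m1 m2 m3) $$ (i, j) = cut_mat m1 m2 m3 $$ (i, j)"
    if "i < dim_row (cut_mat m1 m2 m3)" "j < dim_col (cut_mat m1 m2 m3)" for i j
  proof -
    have "i < m1 + m2 + m3" "j < m1 + m2 + m3"
      using that by (auto simp: cut_mat_def all_ones_mat_def)
    then show ?thesis
      by (auto simp: adj_mat_def cut_graph_def index_cut_mat)
  qed
qed (auto simp: adj_mat_def cut_mat_def all_ones_mat_def)

lemma index_diag_of_vec:
  "i < dim_vec c \<Longrightarrow> j < dim_vec c \<Longrightarrow> diag_of_vec c $$ (i, j) = (if i = j then c $ i else 0)"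
proof -
  have "mk_diagonal as $$ (i, j) = (if i = j then as ! i else 0)"
    if "i < length as" "j < length as" for as :: "real list"
    using that
  proof (induction as arbitrary: i j)
    case (Cons a as)
    then show ?case
      using mk_diagonal_dim[of as]
      by (cases i; cases j) (auto simp: mk_diagonal_def Let_def)
  qed simp
  then show "i < dim_vec c \<Longrightarrow> j < dim_vec c \<Longrightarrow> diag_of_vec c $$ (i, j) = (if i = j then c $ i else 0)"
    unfolding diag_of_vec_def by (metis Matrix.length_list_of_vec list_of_vec_index)
qed

lemma group_aut_group: "group (aut_group G)"
proof (rule groupI)
  fix p assume p: "p \<in> carrier (aut_group G)"
  then have perm: "p permutes pverts G" by (simp add: aut_group_def)
  have "inv_into UNIV p permutes pverts G" using perm by (rule permutes_inv)
  moreover have "(inv_into UNIV p u, inv_into UNIV p v) \<in> parcs G \<longleftrightarrow> (u, v) \<in> parcs G"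
    if "u \<in> pverts G" "v \<in> pverts G" for u v
  proof -
    have "inv_into UNIV p u \<in> pverts G" "inv_into UNIV p v \<in> pverts G"
      using that permutes_in_image[OF permutes_inv[OF perm]] by auto
    then show ?thesis
      using p permutes_inverses(1)[OF perm] by (simp add: aut_group_def) metis
  qed
  ultimately show "\<exists>q \<in> carrier (aut_group G). q \<otimes>\<^bsub>aut_group G\<^esub> p = \<one>\<^bsub>aut_group G\<^esub>"
    by (intro bexI[of _ "inv_into UNIV p"]) (auto simp: aut_group_def permutes_inv_o(2)[OF perm])
qed (auto simp: aut_group_def permutes_compose permutes_id permutes_in_image comp_assoc)

end

theory Submission
  imports Defs
begin


text \<open>
  Every term of the minimum in \<^const>\<open>MC_fix\<close> is bounded below separately: a feasible
  matrix \<open>Y\<close> of order \<open>(n - 2)\<^sup>2\<close> for the reduced problem is extended to a feasible matrix of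
  order \<open>n\<^sup>2\<close> for \<^const>\<open>MC_QAP\<close> with the same objective value. An entry of \<open>Y\<close> belongs to two
  pairs \<open>(s, r)\<close> and \<open>(s', r')\<close>, where \<open>(s, r)\<close> stands for assigning vertex \<open>r\<close> of the graph
  to vertex \<open>s\<close> of the cut graph, and \<open>Y\<close> relaxes the products of the indicators of these
  assignments. Fixing a further assignment \<open>f\<close> therefore means adding a row and a column for
  \<open>f\<close>, with \<open>1\<close> on the diagonal and the diagonal of \<open>Y\<close> as border (an indicator is its own
  product with the indicator of \<open>f\<close>); all remaining new entries are zero. This is done for
  \<open>(s\<^sub>1, r\<^sub>1)\<close> and then for \<open>(s\<^sub>2, r\<^sub>2)\<close>. In the objective the border produces the linear term
  \<open>Diag (vec C)\<close> and the new corner produces the constant \<open>d\<close>.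

  The one point that is not bookkeeping is positive semidefiniteness of the bordered matrix. Let
  \<open>e\<close> be the all-ones vector and \<open>k\<close> the order of the reduced assignment problem. The constraints
  force \<open>Y e = k diag Y\<close> (\<open>row_sum\<close>), so that \<open>diag Y = Y (e / k)\<close>, while \<open>e\<^sup>T Y e = k\<^sup>2\<close>: for
  \<open>k > 0\<close> the bordered form at \<open>(x, t)\<close> is the old form at \<open>x + (t / k) e\<close>. The identity for
  \<open>Y e\<close> is the equality case of the Cauchy-Schwarz inequality. Write \<open>e\<close> as the sum of the \<open>k\<close>
  vectors \<open>w\<^sub>r\<close> that indicate the pairs with second component \<open>r\<close>. Each \<open>w\<^sub>r\<close> has squared length
  \<open>1\<close> in the semi-inner product of \<open>Y\<close>, and their sum has squared length \<open>k\<^sup>2\<close>; hence all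
  \<open>w\<^sub>r\<close> agree modulo the kernel of \<open>Y\<close>. The entry of \<open>Y w\<^sub>r\<close> at \<open>(s, r)\<close> is the diagonal entry,
  because of the zero pattern.

  The two fixed assignments are compatible because an orbital consists of pairs of distinct
  vertices and an edge of the cut graph has distinct endpoints.
\<close>
section \<open>Assignment kernels\<close>


text \<open>The constraints of the semidefinite program, with rows and columns labelled by pairs
  from arbitrary finite sets instead of by positions. With labels, deleting a vertex shrinks
  \<open>S\<close> and \<open>R\<close> without renumbering the others. The constraint with trace zero appears as the zero
  pattern \<open>gangster\<close>, which is equivalent to it for nonnegative entries.\<close>
locale assignment_kernel =
  fixes S :: "'a set" and R :: "'b set" and y :: "'a \<times> 'b \<Rightarrow> 'a \<times> 'b \<Rightarrow> real"
  assumes finite_S: "finite S" and finite_R: "finite R" and card_eq: "card S = card R"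
    and sym: "p \<in> S \<times> R \<Longrightarrow> q \<in> S \<times> R \<Longrightarrow> y p q = y q p"
    and psd: "0 \<le> (\<Sum>p\<in>S \<times> R. \<Sum>q\<in>S \<times> R. x p * y p q * x q)"
    and nonneg: "p \<in> S \<times> R \<Longrightarrow> q \<in> S \<times> R \<Longrightarrow> 0 \<le> y p q"
    and diag_sum_R: "r \<in> R \<Longrightarrow> (\<Sum>s\<in>S. y (s, r) (s, r)) = 1"
    and diag_sum_S: "s \<in> S \<Longrightarrow> (\<Sum>r\<in>R. y (s, r) (s, r)) = 1"
    and gangster: "p \<in> S \<times> R \<Longrightarrow> q \<in> S \<times> R \<Longrightarrow> (fst p = fst q) \<noteq> (snd p = snd q) \<Longrightarrow> y p q = 0"
    and total: "(\<Sum>p\<in>S \<times> R. \<Sum>q\<in>S \<times> R. y p q) = (real (card R))\<^sup>2"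


text \<open>A vector on which a positive semidefinite form vanishes lies in its kernel: otherwise the
  form becomes negative after a small move along a coordinate vector.\<close>
lemma psd_kernel_null_vector:
  fixes y :: "'a \<Rightarrow> 'a \<Rightarrow> real"
  assumes P: "finite P" and sym: "\<And>p q. p \<in> P \<Longrightarrow> q \<in> P \<Longrightarrow> y p q = y q p"
    and psd: "\<And>x. 0 \<le> (\<Sum>p\<in>P. \<Sum>q\<in>P. x p * y p q * x q)"
    and null: "(\<Sum>p\<in>P. \<Sum>q\<in>P. u p * y p q * u q) = 0" and a: "a \<in> P"
  shows "(\<Sum>q\<in>P. y a q * u q) = 0"
proof (rule ccontr)
  define c where "c = (\<Sum>q\<in>P. y a q * u q)"
  assume "(\<Sum>q\<in>P. y a q * u q) \<noteq> 0"
  then have c: "c \<noteq> 0" by (simp add: c_def)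
  have c': "(\<Sum>p\<in>P. u p * y p a) = c"
    unfolding c_def using sym a by (intro sum.cong) auto
  have expand: "0 \<le> 2 * t * c + t\<^sup>2 * y a a" for t
  proof -
    define d where "d p = (if p = a then t else 0)" for p
    have sum_d: "(\<Sum>p\<in>P. d p * F p) = t * F a" for F
      using P a by (simp add: d_def if_distrib[where f="\<lambda>z. z * _"] sum.delta cong: if_cong)
    have sum_d': "(\<Sum>p\<in>P. F p * d p) = t * F a" for F
      using sum_d[of F] by (simp add: mult.commute)
    have "0 \<le> (\<Sum>p\<in>P. \<Sum>q\<in>P. (u p + d p) * y p q * (u q + d q))"
      by (rule psd)
    also have "\<dots> = (\<Sum>p\<in>P. \<Sum>q\<in>P. u p * y p q * u q) + (\<Sum>p\<in>P. \<Sum>q\<in>P. u p * y p q * d q)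
        + (\<Sum>p\<in>P. \<Sum>q\<in>P. d p * (y p q * u q)) + (\<Sum>p\<in>P. \<Sum>q\<in>P. d p * (y p q * d q))"
      by (simp add: sum.distrib[symmetric] algebra_simps)
    also have "(\<Sum>p\<in>P. \<Sum>q\<in>P. u p * y p q * d q) = t * c"
      unfolding sum_d' c'[symmetric] sum_distrib_left ..
    also have "(\<Sum>p\<in>P. \<Sum>q\<in>P. d p * (y p q * u q)) = t * c"
      unfolding sum_distrib_left[symmetric] sum_d c_def ..
    also have "(\<Sum>p\<in>P. \<Sum>q\<in>P. d p * (y p q * d q)) = t\<^sup>2 * y a a"
      unfolding sum_distrib_left[symmetric] sum_d sum_d' by (simp add: power2_eq_square)
    finally show ?thesis using null by (simp add: mult_ac)
  qed

  \<comment> \<open>The quadratic in \<open>t\<close> is negative at \<open>- c / m\<close> once \<open>2 * m\<close> exceeds \<open>y a a\<close>.\<close>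
  define m where "m = \<bar>y a a\<bar> + 1"
  have m: "m > 0" "y a a < 2 * m" by (auto simp: m_def)
  have "0 \<le> 2 * (- c / m) * c + (- c / m)\<^sup>2 * y a a" by (rule expand)
  also have "\<dots> = (c\<^sup>2 / m\<^sup>2) * (y a a - 2 * m)"
    using m by (simp add: field_simps power2_eq_square)
  also have "\<dots> < 0"
    using c m by (intro mult_pos_neg) auto
  finally show False by simp
qed

context assignment_kernel
begin

lemma column_mass:
  assumes "s \<in> S" "r \<in> R"
  shows "(\<Sum>s'\<in>S. y (s, r) (s', r)) = y (s, r) (s, r)"
proof -
  have "(\<Sum>s'\<in>S. y (s, r) (s', r)) = (\<Sum>s'\<in>{s}. y (s, r) (s', r))"
    using assms finite_S by (intro sum.mono_neutral_right) (auto intro!: gangster)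
  then show ?thesis by simp
qed


text \<open>The equality case of the Cauchy-Schwarz inequality for the column indicators \<open>w r\<close>, whose
  Gram matrix is \<open>g\<close>. This identity turns the border, which is the diagonal of \<open>y\<close>, into an
  element of the range of \<open>y\<close>.\<close>
lemma row_sum:
  assumes p: "p \<in> S \<times> R"
  shows "(\<Sum>q\<in>S \<times> R. y p q) = real (card R) * y p p"
proof -
  define P where "P = S \<times> R"
  have finP: "finite P" using finite_S finite_R by (simp add: P_def)
  define w where "w r q = (if snd q = r then 1 else 0 :: real)" for r and q :: "'a \<times> 'b"
  define g where "g r r' = (\<Sum>p\<in>P. \<Sum>q\<in>P. w r p * y p q * w r' q)" for r r'
  have sum_w: "(\<Sum>q\<in>P. f q * w r q) = (\<Sum>s\<in>S. f (s, r))" if "r \<in> R" for f r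
  proof -
    have "(\<Sum>q\<in>P. f q * w r q) = (\<Sum>q\<in>(\<lambda>s. (s, r)) ` S. f q * w r q)"
      using that finP by (intro sum.mono_neutral_right) (auto simp: w_def P_def)
    also have "\<dots> = (\<Sum>s\<in>S. f (s, r))"
      by (subst sum.reindex) (auto simp: inj_on_def w_def)
    finally show ?thesis .
  qed
  have w_one: "(\<Sum>r\<in>R. w r q) = 1" if "q \<in> P" for q
    using that finite_R by (auto simp: w_def P_def sum.delta')
  have g_self: "g r r = 1" if r: "r \<in> R" for r
  proof -
    have "g r r = (\<Sum>p\<in>P. (\<Sum>q\<in>P. y p q * w r q) * w r p)"
      by (simp add: g_def sum_distrib_left sum_distrib_right mult_ac)
    also have "\<dots> = (\<Sum>s\<in>S. \<Sum>s'\<in>S. y (s, r) (s', r))"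
      using r by (simp add: sum_w)
    also have "\<dots> = 1"
      using r by (simp add: column_mass diag_sum_R cong: sum.cong)
    finally show ?thesis .
  qed
  have g_sym: "g r' r = g r r'" for r r'
    unfolding g_def by (subst sum.swap) (auto intro!: sum.cong simp: P_def sym mult_ac)

  \<comment> \<open>The squared length of a difference of two column indicators bounds the Gram entries by \<open>1\<close>;
    their total \<open>k\<^sup>2\<close> then forces every one of them to equal \<open>1\<close>.\<close>
  have Q: "(\<Sum>p\<in>P. \<Sum>q\<in>P. (w r p - w r' p) * y p q * (w r q - w r' q)) = 2 - 2 * g r r'"
    if "r \<in> R" "r' \<in> R" for r r'
  proof -
    have "(\<Sum>p\<in>P. \<Sum>q\<in>P. (w r p - w r' p) * y p q * (w r q - w r' q)) =
       g r r - g r r' - g r' r + g r' r'"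
      by (simp add: g_def sum.distrib[symmetric] sum_subtractf[symmetric] algebra_simps)
    then show ?thesis using that g_self g_sym[of r r'] by simp
  qed
  have g_le: "0 \<le> 1 - g r r'" if "r \<in> R" "r' \<in> R" for r r'
    using psd[of "\<lambda>p. w r p - w r' p"] Q[OF that] by (simp add: P_def)
  have move: "(\<Sum>r\<in>R. \<Sum>p\<in>P. \<Sum>q\<in>P. F r p q) = (\<Sum>p\<in>P. \<Sum>q\<in>P. \<Sum>r\<in>R. F r p q)"
    for F :: "'b \<Rightarrow> 'a \<times> 'b \<Rightarrow> 'a \<times> 'b \<Rightarrow> real"
    by (subst sum.swap, intro sum.cong refl, rule sum.swap)
  have "(\<Sum>r\<in>R. \<Sum>r'\<in>R. g r r') = (\<Sum>p\<in>P. \<Sum>q\<in>P. (\<Sum>r\<in>R. \<Sum>r'\<in>R. w r p * y p q * w r' q))"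
    by (simp only: g_def move)
  also have "\<dots> = (\<Sum>p\<in>P. \<Sum>q\<in>P. y p q)"
    by (intro sum.cong refl)
      (simp add: sum_distrib_left[symmetric] sum_distrib_right[symmetric] w_one)
  finally have "(\<Sum>r\<in>R. \<Sum>r'\<in>R. 1 - g r r') = 0"
    using total by (simp add: sum_subtractf P_def power2_eq_square)
  then have "\<forall>r\<in>R. \<forall>r'\<in>R. 1 - g r r' = 0"
    using finite_R g_le by (simp add: sum_nonneg_eq_0_iff sum_nonneg)
  then have g_one: "g r r' = 1" if "r \<in> R" "r' \<in> R" for r r'
    using that by simp
  obtain s r where sr: "p = (s, r)" "s \<in> S" "r \<in> R" using p by auto
  have "(\<Sum>s'\<in>S. y p (s', r')) = y p p" if r': "r' \<in> R" for r'
  proof -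
    have "(\<Sum>q\<in>P. y p q * (w r' q - w r q)) = 0"
      by (rule psd_kernel_null_vector)
        (use finP sym psd Q[OF r' sr(3)] g_one[OF r' sr(3)] p in \<open>auto simp: P_def\<close>)
    then have "(\<Sum>q\<in>P. y p q * w r' q) = (\<Sum>q\<in>P. y p q * w r q)"
      by (simp add: algebra_simps sum_subtractf)
    then show ?thesis using r' sr by (simp add: sum_w column_mass)
  qed
  then have "(\<Sum>r'\<in>R. \<Sum>s'\<in>S. y p (s', r')) = real (card R) * y p p" by simp
  then show ?thesis by (subst (asm) sum.swap) (simp add: sum.cartesian_product)
qed

lemma trace_eq: "(\<Sum>p\<in>S \<times> R. y p p) = real (card R)"
proof -
  have "(\<Sum>p\<in>S \<times> R. y p p) = (\<Sum>s\<in>S. \<Sum>r\<in>R. y (s, r) (s, r))"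
    by (simp add: sum.cartesian_product)
  then show ?thesis using diag_sum_S card_eq by simp
qed

end

section \<open>Fixing one more assignment\<close>


text \<open>The value \<open>0\<close> off \<open>insert f P\<close> covers the pairs that agree with \<open>f\<close> in exactly one
  component; they cannot be chosen together with \<open>f\<close>.\<close>
definition border :: "'a set \<Rightarrow> 'a \<Rightarrow> ('a \<Rightarrow> 'a \<Rightarrow> real) \<Rightarrow> 'a \<Rightarrow> 'a \<Rightarrow> real" where
  "border P f y p q =
     (if p \<in> P \<and> q \<in> P then y p q
      else if p \<in> P \<and> q = f then y p p
      else if p = f \<and> q \<in> P then y q q
      else if p = f \<and> q = f then 1 else 0)"

lemma border_sym:
  assumes "\<And>p q. p \<in> P \<Longrightarrow> q \<in> P \<Longrightarrow> y p q = y q p" "f \<notin> P"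
  shows "border P f y p q = border P f y q p"
  using assms(1)[of p q] assms(2) by (cases "p \<in> P"; cases "q \<in> P") (auto simp: border_def)

lemma border_nonneg:
  assumes "\<And>p q. p \<in> P \<Longrightarrow> q \<in> P \<Longrightarrow> 0 \<le> y p q"
  shows "0 \<le> border P f y p q"
  using assms by (simp add: border_def)


text \<open>With suitable coefficients \<open>c\<close> this evaluates the quadratic form, the total sum and the
  objective of a bordered kernel.\<close>
lemma sum_border:
  assumes "finite T" "P \<subseteq> T" "f \<in> T" "f \<notin> P"
  shows "(\<Sum>p\<in>T. \<Sum>q\<in>T. c p q * border P f y p q) =
    (\<Sum>p\<in>P. \<Sum>q\<in>P. c p q * y p q) + (\<Sum>p\<in>P. (c p f + c f p) * y p p) + c f f"
proof -
  have finP: "finite P" using assms finite_subset by auto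
  have inner: "(\<Sum>q\<in>T. c p q * border P f y p q) = (\<Sum>q\<in>insert f P. c p q * border P f y p q)" for p
    using assms by (intro sum.mono_neutral_right) (auto simp: border_def)
  have "(\<Sum>p\<in>T. \<Sum>q\<in>T. c p q * border P f y p q) =
      (\<Sum>p\<in>insert f P. \<Sum>q\<in>insert f P. c p q * border P f y p q)"
    unfolding inner using assms by (intro sum.mono_neutral_right) (auto simp: border_def intro!: sum.neutral)
  also have "\<dots> = c f f + (\<Sum>q\<in>P. c f q * y q q) + (\<Sum>p\<in>P. c p f * y p p + (\<Sum>q\<in>P. c p q * y p q))"
    using finP assms(4) by (auto simp: border_def intro!: sum.cong)
  finally show ?thesis by (simp add: sum.distrib algebra_simps)
qed


text \<open>Feasibility survives fixing an assignment of a new \<open>r\<close> to a new \<open>s\<close>. The quadratic form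
  completes to a square by \<open>row_sum\<close>.\<close>
lemma (in assignment_kernel) assignment_kernel_border:
  assumes s: "s \<notin> S" and r: "r \<notin> R"
  shows "assignment_kernel (insert s S) (insert r R) (border (S \<times> R) (s, r) y)"
proof (rule assignment_kernel.intro)
  let ?P = "S \<times> R" and ?f = "(s, r)" and ?T = "insert s S \<times> insert r R"
  let ?b = "border ?P ?f y" and ?k = "real (card R)"
  show fin: "finite (insert s S)" "finite (insert r R)" using finite_S finite_R by auto
  show "card (insert s S) = card (insert r R)" using s r finite_S finite_R card_eq by simp
  have f: "?f \<notin> ?P" using s by simp
  note sum_b = sum_border[of ?T ?P ?f, OF _ _ _ f]
  have T: "finite ?T" "?P \<subseteq> ?T" "?f \<in> ?T" using fin by auto
  show "?b p q = ?b q p" if "p \<in> ?T" "q \<in> ?T" for p q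
    using sym f by (rule border_sym)
  show "0 \<le> ?b p q" if "p \<in> ?T" "q \<in> ?T" for p q
    using nonneg by (rule border_nonneg)
  show "?b p q = 0" if "p \<in> ?T" "q \<in> ?T" "(fst p = fst q) \<noteq> (snd p = snd q)" for p q
  proof (cases "p \<in> ?P \<and> q \<in> ?P")
    case True
    then show ?thesis using gangster[OF _ _ that(3)] by (simp add: border_def)
  next
    case False
    then show ?thesis using that(3) s r by (cases p; cases q) (auto simp: border_def)
  qed
  show "(\<Sum>s'\<in>insert s S. ?b (s', r') (s', r')) = 1" if "r' \<in> insert r R" for r'
  proof (cases "r' = r")
    case True
    have "(\<Sum>s'\<in>S. ?b (s', r) (s', r)) = 0"
      using s r by (intro sum.neutral) (auto simp: border_def)
    then show ?thesis using True s finite_S by (simp add: border_def)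
  next
    case False
    have "(\<Sum>s'\<in>S. ?b (s', r') (s', r')) = (\<Sum>s'\<in>S. y (s', r') (s', r'))"
      using that False by (intro sum.cong) (auto simp: border_def)
    then show ?thesis using that False s finite_S diag_sum_R[of r'] by (simp add: border_def)
  qed
  show "(\<Sum>r'\<in>insert r R. ?b (s', r') (s', r')) = 1" if "s' \<in> insert s S" for s'
  proof (cases "s' = s")
    case True
    have "(\<Sum>r'\<in>R. ?b (s, r') (s, r')) = 0"
      using s r by (intro sum.neutral) (auto simp: border_def)
    then show ?thesis using True r finite_R by (simp add: border_def)
  next
    case False
    have "(\<Sum>r'\<in>R. ?b (s', r') (s', r')) = (\<Sum>r'\<in>R. y (s', r') (s', r'))"
      using that False by (intro sum.cong) (auto simp: border_def)
    then show ?thesis using that False r finite_R diag_sum_S[of s'] by (simp add: border_def)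
  qed
  show "(\<Sum>p\<in>?T. \<Sum>q\<in>?T. ?b p q) = (real (card (insert r R)))\<^sup>2"
    using sum_b[OF T, of "\<lambda>_ _. 1" y] r finite_R
    by (simp add: total trace_eq sum_distrib_left[symmetric] power2_eq_square algebra_simps)
  show "0 \<le> (\<Sum>p\<in>?T. \<Sum>q\<in>?T. x p * ?b p q * x q)" for x
  proof -
    have "(\<Sum>p\<in>?T. \<Sum>q\<in>?T. x p * ?b p q * x q) =
        (\<Sum>p\<in>?P. \<Sum>q\<in>?P. x p * y p q * x q) + 2 * x ?f * (\<Sum>p\<in>?P. x p * y p p) + (x ?f)\<^sup>2"
      using sum_b[OF T, of "\<lambda>p q. x p * x q" y]
      by (simp add: mult_ac power2_eq_square sum_distrib_left)
    also have "0 \<le> \<dots>"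
    proof (cases "card R = 0")
      case True
      then show ?thesis using finite_R by simp
    next
      case False

      \<comment> \<open>The bordered form at \<open>x\<close> is the old form at \<open>x + c\<close>, since \<open>y\<close> maps the constant \<open>c\<close> to
        \<open>x f\<close> times the diagonal.\<close>
      define c where "c = x ?f / ?k"
      have diag: "?k * y p p = (\<Sum>q\<in>?P. y p q)" if "p \<in> ?P" for p
        using row_sum[OF that] by simp
      have diag': "?k * (\<Sum>p\<in>?P. x p * y p p) = (\<Sum>p\<in>?P. \<Sum>q\<in>?P. x p * y p q)"
        unfolding sum_distrib_left
        by (intro sum.cong refl) (use diag in \<open>simp add: mult.left_commute sum_distrib_left[symmetric]\<close>)
      have swap: "(\<Sum>p\<in>?P. \<Sum>q\<in>?P. y p q * x q) = (\<Sum>p\<in>?P. \<Sum>q\<in>?P. x p * y p q)"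
        by (subst sum.swap, intro sum.cong refl) (simp add: sym mult.commute)
      have "0 \<le> (\<Sum>p\<in>?P. \<Sum>q\<in>?P. (x p + c) * y p q * (x q + c))" by (rule psd)
      also have "\<dots> = (\<Sum>p\<in>?P. \<Sum>q\<in>?P. x p * y p q * x q) + c * (\<Sum>p\<in>?P. \<Sum>q\<in>?P. x p * y p q)
          + c * (\<Sum>p\<in>?P. \<Sum>q\<in>?P. y p q * x q) + c * c * (\<Sum>p\<in>?P. \<Sum>q\<in>?P. y p q)"
        by (simp add: sum_distrib_left sum.distrib[symmetric] algebra_simps)
      also have "\<dots> = (\<Sum>p\<in>?P. \<Sum>q\<in>?P. x p * y p q * x q) + 2 * x ?f * (\<Sum>p\<in>?P. x p * y p p) + (x ?f)\<^sup>2"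
        unfolding swap diag'[symmetric] total using False by (simp add: c_def power2_eq_square)
      finally show ?thesis .
    qed
    finally show ?thesis .
  qed
qed

section \<open>Matrices and kernels\<close>


text \<open>Any numbering of the labels \<open>S\<close> and \<open>R\<close> by \<open>{..<k}\<close> numbers the pairs by \<open>{..<k\<^sup>2}\<close>, in
  the order that \<^const>\<open>kron\<close> and \<^const>\<open>vectorize\<close> use. The numbering is a parameter because
  it is the identity for the full problem and the rank within the remaining vertices for the
  reduced one.\<close>
locale pair_indexing =
  fixes k :: nat and S :: "'a set" and R :: "'b set" and \<epsilon> :: "'a \<Rightarrow> nat" and \<rho> :: "'b \<Rightarrow> nat"
  assumes bij_\<epsilon>: "bij_betw \<epsilon> S {..<k}" and bij_\<rho>: "bij_betw \<rho> R {..<k}"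
begin

definition pos :: "'a \<times> 'b \<Rightarrow> nat" where
  "pos p = \<epsilon> (fst p) * k + \<rho> (snd p)"

lemma finite_S: "finite S" and finite_R: "finite R"
  and card_S: "card S = k" and card_R: "card R = k"
  using bij_\<epsilon> bij_\<rho> bij_betw_finite bij_betw_same_card by fastforce+

lemma \<epsilon>_less: "s \<in> S \<Longrightarrow> \<epsilon> s < k" and \<rho>_less: "r \<in> R \<Longrightarrow> \<rho> r < k"
  using bij_\<epsilon> bij_\<rho> by (auto dest: bij_betwE)

lemma \<epsilon>_eq_iff: "s \<in> S \<Longrightarrow> s' \<in> S \<Longrightarrow> \<epsilon> s = \<epsilon> s' \<longleftrightarrow> s = s'"
  and \<rho>_eq_iff: "r \<in> R \<Longrightarrow> r' \<in> R \<Longrightarrow> \<rho> r = \<rho> r' \<longleftrightarrow> r = r'"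
  using bij_\<epsilon> bij_\<rho> by (auto simp: bij_betw_def inj_on_def)

lemma pos_div: "p \<in> S \<times> R \<Longrightarrow> pos p div k = \<epsilon> (fst p)"
  and pos_mod: "p \<in> S \<times> R \<Longrightarrow> pos p mod k = \<rho> (snd p)"
  using \<rho>_less[of "snd p"] by (auto simp: pos_def)

lemma bij_pos: "bij_betw pos (S \<times> R) {..<k\<^sup>2}"
proof -
  have less: "i * k + j < k\<^sup>2" if "i < k" "j < k" for i j
  proof -
    have "i * k + j < Suc i * k" using that by simp
    also have "\<dots> \<le> k * k" using that by (intro mult_le_mono1) simp
    finally show ?thesis by (simp add: power2_eq_square)
  qed
  have "bij_betw (\<lambda>(i, j). i * k + j) ({..<k} \<times> {..<k}) {..<k\<^sup>2}"
  proof (rule bij_betw_byWitness[where f' = "\<lambda>m. (m div k, m mod k)"])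
    show "(\<lambda>m. (m div k, m mod k)) ` {..<k\<^sup>2} \<subseteq> {..<k} \<times> {..<k}"
    proof
      fix z assume "z \<in> (\<lambda>m. (m div k, m mod k)) ` {..<k\<^sup>2}"
      then obtain m where m: "m < k * k" "z = (m div k, m mod k)"
        by (auto simp: power2_eq_square)
      then have "k > 0" by (cases k) auto
      with m show "z \<in> {..<k} \<times> {..<k}" by (simp add: less_mult_imp_div_less)
    qed
  qed (auto simp: less)
  moreover have "bij_betw (map_prod \<epsilon> \<rho>) (S \<times> R) ({..<k} \<times> {..<k})"
    using bij_\<epsilon> bij_\<rho> by (rule bij_betw_map_prod)
  ultimately have "bij_betw ((\<lambda>(i, j). i * k + j) \<circ> map_prod \<epsilon> \<rho>) (S \<times> R) {..<k\<^sup>2}"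
    using bij_betw_trans by blast
  moreover have "(\<lambda>(i, j). i * k + j) \<circ> map_prod \<epsilon> \<rho> = pos"
    by (auto simp: pos_def fun_eq_iff)
  ultimately show ?thesis by simp
qed

lemma pos_less: "p \<in> S \<times> R \<Longrightarrow> pos p < k\<^sup>2"
  using bij_pos by (auto dest: bij_betwE)

lemma pos_eq_iff: "p \<in> S \<times> R \<Longrightarrow> q \<in> S \<times> R \<Longrightarrow> pos p = pos q \<longleftrightarrow> p = q"
  using bij_pos by (auto simp: bij_betw_def inj_on_def)

lemma sum_pos: "(\<Sum>i<k\<^sup>2. f i) = (\<Sum>p\<in>S \<times> R. f (pos p))"
  using sum.reindex_bij_betw[OF bij_pos, of f] by simp

lemma all_pos: "(\<forall>i<k\<^sup>2. Q i) \<longleftrightarrow> (\<forall>p\<in>S \<times> R. Q (pos p))"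
proof -
  have "pos ` (S \<times> R) = {..<k\<^sup>2}" using bij_pos by (simp add: bij_betw_def)
  then show ?thesis by (metis (no_types, lifting) imageE imageI lessThan_iff)
qed

end


text \<open>The kernel \<open>y\<close> is a parameter and not defined from \<open>Y\<close>, so that the correspondence serves
  in both directions: from a given matrix to its kernel, and from a bordered kernel, prescribed
  only on the pairs, to a matrix.\<close>
locale kernel_matrix = pair_indexing +
  fixes Y :: "real mat" and y :: "'a \<times> 'b \<Rightarrow> 'a \<times> 'b \<Rightarrow> real"
  assumes Y: "Y \<in> carrier_mat (k\<^sup>2) (k\<^sup>2)"
    and entry: "p \<in> S \<times> R \<Longrightarrow> q \<in> S \<times> R \<Longrightarrow> Y $$ (pos p, pos q) = y p q"
begin

lemma trace_mult:
  assumes M: "M \<in> carrier_mat (k\<^sup>2) (k\<^sup>2)"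
  shows "mat_trace (M * Y) = (\<Sum>p\<in>S \<times> R. \<Sum>q\<in>S \<times> R. M $$ (pos q, pos p) * y p q)"
proof -
  have "mat_trace (M * Y) = (\<Sum>i<k\<^sup>2. \<Sum>j<k\<^sup>2. M $$ (i, j) * Y $$ (j, i))"
    using M Y by (auto simp: mat_trace_def scalar_prod_def lessThan_atLeast0 intro!: sum.cong)
  also have "\<dots> = (\<Sum>j<k\<^sup>2. \<Sum>i<k\<^sup>2. M $$ (i, j) * Y $$ (j, i))"
    by (rule sum.swap)
  also have "\<dots> = (\<Sum>p\<in>S \<times> R. \<Sum>q\<in>S \<times> R. M $$ (pos q, pos p) * y p q)"
    unfolding sum_pos by (intro sum.cong refl) (simp add: entry)
  finally show ?thesis .
qed

lemma kron_entry:
  assumes "M \<in> carrier_mat k k" "N \<in> carrier_mat k k" "p \<in> S \<times> R" "q \<in> S \<times> R"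
  shows "(M \<otimes>\<^sub>m N) $$ (pos p, pos q) =
    M $$ (\<epsilon> (fst p), \<epsilon> (fst q)) * N $$ (\<rho> (snd p), \<rho> (snd q))"
  using assms pos_less[OF assms(3)] pos_less[OF assms(4)]
  by (simp add: kron_def pos_div pos_mod power2_eq_square)

lemma kron_carrier:
  "M \<in> carrier_mat k k \<Longrightarrow> N \<in> carrier_mat k k \<Longrightarrow> M \<otimes>\<^sub>m N \<in> carrier_mat (k\<^sup>2) (k\<^sup>2)"
  by (simp add: kron_def power2_eq_square)

lemma symmetric_iff:
  "transpose_mat Y = Y \<longleftrightarrow> (\<forall>p\<in>S \<times> R. \<forall>q\<in>S \<times> R. y p q = y q p)"
proof -
  have "transpose_mat Y = Y \<longleftrightarrow> (\<forall>i<k\<^sup>2. \<forall>j<k\<^sup>2. Y $$ (i, j) = Y $$ (j, i))"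
    using Y by (auto simp: mat_eq_iff)
  then show ?thesis unfolding all_pos by (simp add: entry)
qed

lemma nonneg_iff:
  "0\<^sub>m (k\<^sup>2) (k\<^sup>2) \<le> Y \<longleftrightarrow> (\<forall>p\<in>S \<times> R. \<forall>q\<in>S \<times> R. 0 \<le> y p q)"
proof -
  have "0\<^sub>m (k\<^sup>2) (k\<^sup>2) \<le> Y \<longleftrightarrow> (\<forall>i<k\<^sup>2. \<forall>j<k\<^sup>2. 0 \<le> Y $$ (i, j))"
    using Y by (auto simp: less_eq_mat_def)
  then show ?thesis unfolding all_pos by (simp add: entry)
qed

lemma psd_iff:
  "(\<forall>v\<in>carrier_vec (k\<^sup>2). 0 \<le> v \<bullet> (Y *\<^sub>v v)) \<longleftrightarrow>
    (\<forall>x. 0 \<le> (\<Sum>p\<in>S \<times> R. \<Sum>q\<in>S \<times> R. x p * y p q * x q))"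
proof -
  have form: "v \<bullet> (Y *\<^sub>v v) = (\<Sum>p\<in>S \<times> R. \<Sum>q\<in>S \<times> R. v $ pos p * y p q * v $ pos q)"
    if v: "v \<in> carrier_vec (k\<^sup>2)" for v
  proof -
    have "v \<bullet> (Y *\<^sub>v v) = (\<Sum>i<k\<^sup>2. \<Sum>j<k\<^sup>2. v $ i * Y $$ (i, j) * v $ j)"
      using v Y by (auto simp: scalar_prod_def lessThan_atLeast0 sum_distrib_left mult_ac intro!: sum.cong)
    also have "\<dots> = (\<Sum>p\<in>S \<times> R. \<Sum>q\<in>S \<times> R. v $ pos p * y p q * v $ pos q)"
      unfolding sum_pos by (intro sum.cong refl) (simp add: entry)
    finally show ?thesis .
  qed
  show ?thesis
  proof (intro iffI allI ballI)
    fix x :: "'a \<times> 'b \<Rightarrow> real"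
    assume psd: "\<forall>v\<in>carrier_vec (k\<^sup>2). 0 \<le> v \<bullet> (Y *\<^sub>v v)"
    define v where "v = vec (k\<^sup>2) (\<lambda>i. x (inv_into (S \<times> R) pos i))"
    have v: "v \<in> carrier_vec (k\<^sup>2)" by (simp add: v_def)
    have "v $ pos p = x p" if "p \<in> S \<times> R" for p
      unfolding v_def using pos_less[OF that] bij_betw_inv_into_left[OF bij_pos that] by simp
    then have "(\<Sum>p\<in>S \<times> R. \<Sum>q\<in>S \<times> R. x p * y p q * x q) = v \<bullet> (Y *\<^sub>v v)"
      unfolding form[OF v] by (intro sum.cong refl) simp
    then show "0 \<le> (\<Sum>p\<in>S \<times> R. \<Sum>q\<in>S \<times> R. x p * y p q * x q)"
      using psd v by simp
  next
    fix v :: "real vec"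
    assume "\<forall>x. 0 \<le> (\<Sum>p\<in>S \<times> R. \<Sum>q\<in>S \<times> R. x p * y p q * x q)" "v \<in> carrier_vec (k\<^sup>2)"
    then show "0 \<le> v \<bullet> (Y *\<^sub>v v)" using form by simp
  qed
qed

lemma trace_id_unit:
  assumes r: "r \<in> R"
  shows "mat_trace ((1\<^sub>m k \<otimes>\<^sub>m E\<^sub>m k (\<rho> r)) * Y) = (\<Sum>s\<in>S. y (s, r) (s, r))"
proof -
  have "mat_trace ((1\<^sub>m k \<otimes>\<^sub>m E\<^sub>m k (\<rho> r)) * Y) =
      (\<Sum>p\<in>S \<times> R. \<Sum>q\<in>S \<times> R. (1\<^sub>m k \<otimes>\<^sub>m E\<^sub>m k (\<rho> r)) $$ (pos q, pos p) * y p q)"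
    by (intro trace_mult kron_carrier) (auto simp: diag_unit_mat_def)
  also have "\<dots> = (\<Sum>p\<in>S \<times> R. \<Sum>q\<in>S \<times> R. if q = p then (if snd p = r then y p q else 0) else 0)"
    using r by (intro sum.cong refl, subst kron_entry)
      (auto simp: diag_unit_mat_def \<epsilon>_less \<rho>_less \<epsilon>_eq_iff \<rho>_eq_iff split: if_splits)
  also have "\<dots> = (\<Sum>p\<in>S \<times> R. if snd p = r then y p p else 0)"
    using finite_S finite_R by (simp add: sum.delta)
  also have "\<dots> = (\<Sum>(s, r')\<in>S \<times> R. if r' = r then y (s, r') (s, r') else 0)"
    by (intro sum.cong) auto
  also have "\<dots> = (\<Sum>s\<in>S. \<Sum>r'\<in>R. if r' = r then y (s, r') (s, r') else 0)"
    by (simp add: sum.cartesian_product)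
  finally show ?thesis using r finite_R by (simp add: sum.delta)
qed

lemma trace_unit_id:
  assumes s: "s \<in> S"
  shows "mat_trace ((E\<^sub>m k (\<epsilon> s) \<otimes>\<^sub>m 1\<^sub>m k) * Y) = (\<Sum>r\<in>R. y (s, r) (s, r))"
proof -
  have "mat_trace ((E\<^sub>m k (\<epsilon> s) \<otimes>\<^sub>m 1\<^sub>m k) * Y) =
      (\<Sum>p\<in>S \<times> R. \<Sum>q\<in>S \<times> R. (E\<^sub>m k (\<epsilon> s) \<otimes>\<^sub>m 1\<^sub>m k) $$ (pos q, pos p) * y p q)"
    by (intro trace_mult kron_carrier) (auto simp: diag_unit_mat_def)
  also have "\<dots> = (\<Sum>p\<in>S \<times> R. \<Sum>q\<in>S \<times> R. if q = p then (if fst p = s then y p q else 0) else 0)"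
    using s by (intro sum.cong refl, subst kron_entry)
      (auto simp: diag_unit_mat_def \<epsilon>_less \<rho>_less \<epsilon>_eq_iff \<rho>_eq_iff split: if_splits)
  also have "\<dots> = (\<Sum>p\<in>S \<times> R. if fst p = s then y p p else 0)"
    using finite_S finite_R by (simp add: sum.delta)
  also have "\<dots> = (\<Sum>(s', r)\<in>S \<times> R. if s' = s then y (s', r) (s', r) else 0)"
    by (intro sum.cong) auto
  also have "\<dots> = (\<Sum>r\<in>R. \<Sum>s'\<in>S. if s' = s then y (s', r) (s', r) else 0)"
    by (subst sum.swap) (simp add: sum.cartesian_product)
  finally show ?thesis using s finite_S by (simp add: sum.delta)
qed

lemma trace_gangster:
  "mat_trace ((1\<^sub>m k \<otimes>\<^sub>m (J\<^sub>m k k - 1\<^sub>m k) + (J\<^sub>m k k - 1\<^sub>m k) \<otimes>\<^sub>m 1\<^sub>m k) * Y) =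
    (\<Sum>p\<in>S \<times> R. \<Sum>q\<in>S \<times> R. if (fst p = fst q) \<noteq> (snd p = snd q) then y p q else 0)"
  (is "mat_trace ((?U + ?V) * Y) = _")
proof -
  have IJ: "1\<^sub>m k \<in> carrier_mat k k" "J\<^sub>m k k - 1\<^sub>m k \<in> carrier_mat k k"
    by (auto simp: all_ones_mat_def)
  note U = kron_carrier[OF IJ] and V = kron_carrier[OF IJ(2) IJ(1)]
  have "(?U + ?V) $$ (pos q, pos p) = (if (fst p = fst q) \<noteq> (snd p = snd q) then 1 else 0)"
    if p: "p \<in> S \<times> R" and q: "q \<in> S \<times> R" for p q
  proof -
    have "(?U + ?V) $$ (pos q, pos p) = ?U $$ (pos q, pos p) + ?V $$ (pos q, pos p)"
      using U V p q by (intro index_add_mat) (auto simp: pos_less)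
    then show ?thesis
      unfolding kron_entry[OF IJ q p] kron_entry[OF IJ(2) IJ(1) q p] using p q
      by (auto simp: all_ones_mat_def \<epsilon>_less \<rho>_less \<epsilon>_eq_iff \<rho>_eq_iff)
  qed
  then show ?thesis
    using U V by (subst trace_mult) (auto intro!: sum.cong)
qed

lemma trace_all_ones:
  "mat_trace (J\<^sub>m (k\<^sup>2) (k\<^sup>2) * Y) = (\<Sum>p\<in>S \<times> R. \<Sum>q\<in>S \<times> R. y p q)"
  by (subst trace_mult) (auto simp: all_ones_mat_def pos_less intro!: sum.cong)


text \<open>The bridge between the semidefinite program and its label form. Nonnegativity of the entries is
  what splits the single trace equation into the zero pattern.\<close>
lemma qap_feasible_iff: "Y \<in> qap_feasible k \<longleftrightarrow> assignment_kernel S R y"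
proof -
  let ?P = "S \<times> R"
  have finP: "finite ?P" using finite_S finite_R by simp
  have all_\<rho>: "(\<forall>j<k. Q j) \<longleftrightarrow> (\<forall>r\<in>R. Q (\<rho> r))" for Q
    using bij_\<rho> unfolding bij_betw_def by (metis imageE imageI lessThan_iff)
  have all_\<epsilon>: "(\<forall>j<k. Q j) \<longleftrightarrow> (\<forall>s\<in>S. Q (\<epsilon> s))" for Q
    using bij_\<epsilon> unfolding bij_betw_def by (metis imageE imageI lessThan_iff)
  have card_S_eq_card_R: "card S = card R" by (simp add: card_S card_R)
  have zero: "(\<Sum>p\<in>?P. \<Sum>q\<in>?P. if (fst p = fst q) \<noteq> (snd p = snd q) then y p q else 0) = 0 \<longleftrightarrow>
      (\<forall>p\<in>?P. \<forall>q\<in>?P. (fst p = fst q) \<noteq> (snd p = snd q) \<longrightarrow> y p q = 0)"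
    if "\<forall>p\<in>?P. \<forall>q\<in>?P. 0 \<le> y p q"
  proof -
    have "(\<Sum>p\<in>?P. \<Sum>q\<in>?P. if (fst p = fst q) \<noteq> (snd p = snd q) then y p q else 0) = 0 \<longleftrightarrow>
      (\<forall>p\<in>?P. (\<Sum>q\<in>?P. if (fst p = fst q) \<noteq> (snd p = snd q) then y p q else 0) = 0)"
      using that finP by (intro sum_nonneg_eq_0_iff sum_nonneg) auto
    also have "\<dots> \<longleftrightarrow> (\<forall>p\<in>?P. \<forall>q\<in>?P. (if (fst p = fst q) \<noteq> (snd p = snd q) then y p q else 0) = 0)"
      using that finP by (intro ball_cong refl sum_nonneg_eq_0_iff) auto
    finally show ?thesis by (simp cong: if_cong)
  qed
  have "Y \<in> qap_feasible k \<longleftrightarrow>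
      (\<forall>p\<in>?P. \<forall>q\<in>?P. y p q = y q p) \<and>
      (\<forall>x. 0 \<le> (\<Sum>p\<in>?P. \<Sum>q\<in>?P. x p * y p q * x q)) \<and>
      (\<forall>p\<in>?P. \<forall>q\<in>?P. 0 \<le> y p q) \<and>
      (\<forall>r\<in>R. (\<Sum>s\<in>S. y (s, r) (s, r)) = 1) \<and>
      (\<forall>s\<in>S. (\<Sum>r\<in>R. y (s, r) (s, r)) = 1) \<and>
      (\<Sum>p\<in>?P. \<Sum>q\<in>?P. if (fst p = fst q) \<noteq> (snd p = snd q) then y p q else 0) = 0 \<and>
      (\<Sum>p\<in>?P. \<Sum>q\<in>?P. y p q) = (real (card R))\<^sup>2"
    unfolding qap_feasible_def psd_mats_def mem_Collect_eq symmetric_iff psd_iff nonneg_iff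
      trace_gangster trace_all_ones all_\<rho>[of "\<lambda>j. mat_trace ((1\<^sub>m k \<otimes>\<^sub>m E\<^sub>m k j) * Y) = 1"]
      all_\<epsilon>[of "\<lambda>j. mat_trace ((E\<^sub>m k j \<otimes>\<^sub>m 1\<^sub>m k) * Y) = 1"]
    using Y by (simp only: trace_id_unit trace_unit_id card_R of_nat_power conj_assoc cong: ball_cong) simp
  also have "\<dots> \<longleftrightarrow>
      (\<forall>p\<in>?P. \<forall>q\<in>?P. y p q = y q p) \<and>
      (\<forall>x. 0 \<le> (\<Sum>p\<in>?P. \<Sum>q\<in>?P. x p * y p q * x q)) \<and>
      (\<forall>p\<in>?P. \<forall>q\<in>?P. 0 \<le> y p q) \<and>
      (\<forall>r\<in>R. (\<Sum>s\<in>S. y (s, r) (s, r)) = 1) \<and>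
      (\<forall>s\<in>S. (\<Sum>r\<in>R. y (s, r) (s, r)) = 1) \<and>
      (\<forall>p\<in>?P. \<forall>q\<in>?P. (fst p = fst q) \<noteq> (snd p = snd q) \<longrightarrow> y p q = 0) \<and>
      (\<Sum>p\<in>?P. \<Sum>q\<in>?P. y p q) = (real (card R))\<^sup>2"
    using zero by blast
  also have "\<dots> \<longleftrightarrow> assignment_kernel S R y"
    unfolding assignment_kernel_def using finite_S finite_R card_S_eq_card_R by blast
  finally show ?thesis .
qed

end


section \<open>Comparison of the relaxations\<close>


text \<open>The rank of an element within \<open>I\<close> is its row or column number in a \<^const>\<open>submatrix\<close> with
  index set \<open>I\<close>.\<close>
lemma bij_betw_rank:
  fixes I :: "nat set"
  assumes "finite I"
  shows "bij_betw (\<lambda>i. card {a \<in> I. a < i}) I {..<card I}"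
proof -
  have less: "card {a \<in> I. a < i} < card {a \<in> I. a < j}" if "i \<in> I" "i < j" for i j
    using that assms by (intro psubset_card_mono) auto
  have inj: "inj_on (\<lambda>i. card {a \<in> I. a < i}) I"
  proof (rule inj_onI)
    fix i j assume "i \<in> I" "j \<in> I" "card {a \<in> I. a < i} = card {a \<in> I. a < j}"
    then show "i = j" using less[of i j] less[of j i] by (metis less_irrefl linorder_neqE_nat)
  qed
  have "(\<lambda>i. card {a \<in> I. a < i}) ` I \<subseteq> {..<card I}"
    using assms by (auto intro!: psubset_card_mono)
  then have "(\<lambda>i. card {a \<in> I. a < i}) ` I = {..<card I}"
    using card_image[OF inj] by (intro card_subset_eq) auto
  with inj show ?thesis by (simp add: bij_betw_def)
qed

lemma sum_border_diag:
  assumes "finite P" "f \<notin> P"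
  shows "(\<Sum>p\<in>insert f P. d p * border P f y p p) = (\<Sum>p\<in>P. d p * y p p) + d f"
proof -
  have "(\<Sum>p\<in>P. d p * border P f y p p) = (\<Sum>p\<in>P. d p * y p p)"
    by (intro sum.cong) (auto simp: border_def)
  then show ?thesis using assms by (simp add: border_def)
qed


text \<open>The extension by both fixed assignments. With \<open>c p q\<close> the coefficient of the entry at
  \<open>p, q\<close> in the objective, bordering by \<open>f\<close> adds \<open>c p f + c f p\<close> on the diagonal of the old
  kernel and \<open>c f f\<close>. The second border also meets the first fixed pair, which contributes the
  mixed term \<open>2 * A $$ (r1, r2) * B $$ (s1, s2)\<close> of \<^const>\<open>fix_d\<close>.\<close>
lemma fix_pair_feasible:
  fixes n s1 s2 r1 r2 :: nat and A B Y :: "real mat"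
  defines "\<alpha> \<equiv> {0..<n} - {r1, r2}" and "\<beta> \<equiv> {0..<n} - {s1, s2}"
  assumes A: "A \<in> carrier_mat n n" "transpose_mat A = A"
    and B: "B \<in> carrier_mat n n" "transpose_mat B = B"
    and s: "s1 < n" "s2 < n" "s1 \<noteq> s2" and r: "r1 < n" "r2 < n" "r1 \<noteq> r2"
    and Y: "Y \<in> qap_feasible (n - 2)"
  obtains Z where "Z \<in> qap_feasible n"
    and "mat_trace ((B \<otimes>\<^sub>m A) * Z) =
      mat_trace ((submatrix B \<beta> \<beta> \<otimes>\<^sub>m submatrix A \<alpha> \<alpha> +
        diag_of_vec (vectorize (fix_C n A B s1 s2 r1 r2))) * Y) + fix_d A B s1 s2 r1 r2"
proof -
  have A_sym: "A $$ (i, j) = A $$ (j, i)" if "i < n" "j < n" for i j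
    using A that by (metis carrier_matD index_transpose_mat(1))
  have B_sym: "B $$ (i, j) = B $$ (j, i)" if "i < n" "j < n" for i j
    using B that by (metis carrier_matD index_transpose_mat(1))
  define \<epsilon> where "\<epsilon> s = card {a \<in> \<beta>. a < s}" for s
  define \<rho> where "\<rho> r = card {a \<in> \<alpha>. a < r}" for r
  have fin: "finite \<alpha>" "finite \<beta>" by (auto simp: \<alpha>_def \<beta>_def)
  have card: "card \<alpha> = n - 2" "card \<beta> = n - 2"
    using s r by (auto simp: \<alpha>_def \<beta>_def card_Diff_subset)
  have sub: "{i. i < n \<and> i \<in> \<alpha>} = \<alpha>" "{i. i < n \<and> i \<in> \<beta>} = \<beta>"
    by (auto simp: \<alpha>_def \<beta>_def)
  have less: "i < n" if "i \<in> \<alpha> \<or> i \<in> \<beta>" for i using that by (auto simp: \<alpha>_def \<beta>_def)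
  interpret small: pair_indexing "n - 2" \<beta> \<alpha> \<epsilon> \<rho>
    using bij_betw_rank[OF fin(1)] bij_betw_rank[OF fin(2)]
    by unfold_locales (simp_all add: card \<epsilon>_def[abs_def] \<rho>_def[abs_def])
  define y where "y p q = Y $$ (small.pos p, small.pos q)" for p q
  interpret small: kernel_matrix "n - 2" \<beta> \<alpha> \<epsilon> \<rho> Y y
    using Y by unfold_locales (auto simp: y_def qap_feasible_def psd_mats_def)
  have ker: "assignment_kernel \<beta> \<alpha> y" using small.qap_feasible_iff Y by simp
  let ?f1 = "(s1, r1)" and ?f2 = "(s2, r2)" and ?P = "\<beta> \<times> \<alpha>"
  let ?\<beta>1 = "insert s1 \<beta>" and ?\<alpha>1 = "insert r1 \<alpha>" and ?N = "{..<n} \<times> {..<n}"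
  let ?P1 = "?\<beta>1 \<times> ?\<alpha>1"

  \<comment> \<open>Here \<open>y1 f1 f1 = 1\<close>, so the second border assigns \<open>1\<close> to the pair of \<open>f1\<close> and \<open>f2\<close>, as both
    assignments hold.\<close>
  define y1 where "y1 = border ?P ?f1 y"
  define z where "z = border ?P1 ?f2 y1"
  have "assignment_kernel ?\<beta>1 ?\<alpha>1 y1"
    unfolding y1_def using ker by (rule assignment_kernel.assignment_kernel_border) (auto simp: \<alpha>_def \<beta>_def)
  then have "assignment_kernel (insert s2 ?\<beta>1) (insert r2 ?\<alpha>1) z"
    unfolding z_def using s r
    by (intro assignment_kernel.assignment_kernel_border) (auto simp: \<alpha>_def \<beta>_def)
  moreover have "insert s2 ?\<beta>1 = {..<n}" "insert r2 ?\<alpha>1 = {..<n}"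
    using s r by (auto simp: \<alpha>_def \<beta>_def)
  ultimately have ker_z: "assignment_kernel {..<n} {..<n} z" by simp
  interpret big: pair_indexing n "{..<n}" "{..<n}" "\<lambda>i. i" "\<lambda>i. i"
    by unfold_locales (auto simp: bij_betw_def)
  define Z where "Z = mat (n\<^sup>2) (n\<^sup>2) (\<lambda>(i, j). z (i div n, i mod n) (j div n, j mod n))"
  interpret big: kernel_matrix n "{..<n}" "{..<n}" "\<lambda>i. i" "\<lambda>i. i" Z z
  proof
    show "Z $$ (big.pos p, big.pos q) = z p q" if "p \<in> ?N" "q \<in> ?N" for p q
      using that by (simp add: Z_def big.pos_less big.pos_div big.pos_mod)
  qed (simp add: Z_def)
  define c where "c p q = B $$ (fst q, fst p) * A $$ (snd q, snd p)" for p q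
  have finP: "finite ?P" "finite ?P1" "finite ?N" using fin by auto
  have notin: "?f1 \<notin> ?P" "?f2 \<notin> ?P1" using s by (auto simp: \<beta>_def)
  have c_sym: "c p q = c q p" if "p \<in> ?N" "q \<in> ?N" for p q
    using that A_sym B_sym by (auto simp: c_def)
  have incl: "?P \<subseteq> ?P1" "?P1 \<subseteq> ?N" "?f1 \<in> ?P1" "?f2 \<in> ?N" "?f1 \<in> ?N" "?P \<subseteq> ?N"
    using s r by (auto simp: \<alpha>_def \<beta>_def)
  have "mat_trace ((B \<otimes>\<^sub>m A) * Z) = (\<Sum>p\<in>?N. \<Sum>q\<in>?N. c p q * z p q)"
    by (subst big.trace_mult) (auto intro!: sum.cong big.kron_carrier A B simp: big.kron_entry A B c_def)
  also have "\<dots> = (\<Sum>p\<in>?P1. \<Sum>q\<in>?P1. c p q * y1 p q) + (\<Sum>p\<in>?P1. (c p ?f2 + c ?f2 p) * y1 p p) + c ?f2 ?f2"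
    unfolding z_def by (rule sum_border) (use finP incl notin in auto)
  also have "(\<Sum>p\<in>?P1. \<Sum>q\<in>?P1. c p q * y1 p q) =
      (\<Sum>p\<in>?P. \<Sum>q\<in>?P. c p q * y p q) + (\<Sum>p\<in>?P. (c p ?f1 + c ?f1 p) * y p p) + c ?f1 ?f1"
    unfolding y1_def by (rule sum_border) (use finP incl notin in auto)
  also have "(\<Sum>p\<in>?P1. (c p ?f2 + c ?f2 p) * y1 p p) = (\<Sum>p\<in>insert ?f1 ?P. (c p ?f2 + c ?f2 p) * y1 p p)"
    using finP incl by (intro sum.mono_neutral_right) (auto simp: y1_def border_def)
  also have "\<dots> = (\<Sum>p\<in>?P. (c p ?f2 + c ?f2 p) * y p p) + (c ?f1 ?f2 + c ?f2 ?f1)"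
    unfolding y1_def by (rule sum_border_diag) (use finP notin in auto)
  finally have big_trace: "mat_trace ((B \<otimes>\<^sub>m A) * Z) = (\<Sum>p\<in>?P. \<Sum>q\<in>?P. c p q * y p q)
      + (\<Sum>p\<in>?P. (2 * c ?f1 p + 2 * c ?f2 p) * y p p) + fix_d A B s1 s2 r1 r2"
  proof -
    assume *: "mat_trace ((B \<otimes>\<^sub>m A) * Z) = (\<Sum>p\<in>?P. \<Sum>q\<in>?P. c p q * y p q)
        + (\<Sum>p\<in>?P. (c p ?f1 + c ?f1 p) * y p p) + c ?f1 ?f1
        + ((\<Sum>p\<in>?P. (c p ?f2 + c ?f2 p) * y p p) + (c ?f1 ?f2 + c ?f2 ?f1)) + c ?f2 ?f2"
    have "(\<Sum>p\<in>?P. (c p ?f1 + c ?f1 p) * y p p) + (\<Sum>p\<in>?P. (c p ?f2 + c ?f2 p) * y p p) =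
        (\<Sum>p\<in>?P. (2 * c ?f1 p + 2 * c ?f2 p) * y p p)"
      unfolding sum.distrib[symmetric]
    proof (rule sum.cong[OF refl])
      fix p assume "p \<in> ?P"
      then have "p \<in> ?N" using incl by blast
      then have "c p ?f1 = c ?f1 p" "c p ?f2 = c ?f2 p" using incl c_sym by blast+
      then show "(c p ?f1 + c ?f1 p) * y p p + (c p ?f2 + c ?f2 p) * y p p =
          (2 * c ?f1 p + 2 * c ?f2 p) * y p p"
        by (simp add: algebra_simps)
    qed
    moreover have "fix_d A B s1 s2 r1 r2 = c ?f1 ?f1 + c ?f2 ?f2 + (c ?f1 ?f2 + c ?f2 ?f1)"
      using A_sym[OF r(1,2)] B_sym[OF s(1,2)] by (simp add: fix_d_def c_def)
    ultimately show ?thesis using * by simp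
  qed
  let ?K = "submatrix B \<beta> \<beta> \<otimes>\<^sub>m submatrix A \<alpha> \<alpha>"
  let ?v = "vectorize (fix_C n A B s1 s2 r1 r2)"
  have subA: "submatrix A \<alpha> \<alpha> \<in> carrier_mat (n - 2) (n - 2)"
    and subB: "submatrix B \<beta> \<beta> \<in> carrier_mat (n - 2) (n - 2)"
    using A B by (auto simp: dim_submatrix sub card)
  have single: "{j. j < n \<and> j \<in> {i}} = {i}" "{a. a = i \<and> a < i} = {}" if "i < n" for i :: nat
    using that by auto
  have C: "fix_C n A B s1 s2 r1 r2 \<in> carrier_mat (n - 2) (n - 2)"
    using A B by (auto simp: fix_C_def Let_def dim_submatrix sub card \<alpha>_def[symmetric] \<beta>_def[symmetric])
  have outer: "(submatrix A \<alpha> {ri} * submatrix B {si} \<beta>) $$ (\<rho> r, \<epsilon> s) = A $$ (r, ri) * B $$ (si, s)"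
    if "r \<in> \<alpha>" "s \<in> \<beta>" "ri < n" "si < n" for r s ri si
  proof -
    have "submatrix A \<alpha> {ri} $$ (\<rho> r, 0) = A $$ (r, ri)"
      using submatrix_index_card[of r A ri \<alpha> "{ri}"] that less A by (simp add: \<rho>_def single)
    moreover have "submatrix B {si} \<beta> $$ (0, \<epsilon> s) = B $$ (si, s)"
      using submatrix_index_card[of si B s "{si}" \<beta>] that less B by (simp add: \<epsilon>_def single)
    ultimately show ?thesis
      using that A B small.\<rho>_less small.\<epsilon>_less single
      by (simp add: dim_submatrix sub card scalar_prod_def)
  qed
  have C_entry: "fix_C n A B s1 s2 r1 r2 $$ (\<rho> (snd p), \<epsilon> (fst p)) = 2 * c ?f1 p + 2 * c ?f2 p"
    if p: "p \<in> ?P" for p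
  proof -
    have "fix_C n A B s1 s2 r1 r2 $$ (\<rho> (snd p), \<epsilon> (fst p)) =
        2 * (submatrix A \<alpha> {r1} * submatrix B {s1} \<beta>) $$ (\<rho> (snd p), \<epsilon> (fst p)) +
        2 * (submatrix A \<alpha> {r2} * submatrix B {s2} \<beta>) $$ (\<rho> (snd p), \<epsilon> (fst p))"
      using C p small.\<rho>_less small.\<epsilon>_less A B
      by (auto simp: fix_C_def Let_def dim_submatrix sub card \<alpha>_def[symmetric] \<beta>_def[symmetric])
    also have "\<dots> = 2 * (A $$ (snd p, r1) * B $$ (s1, fst p)) + 2 * (A $$ (snd p, r2) * B $$ (s2, fst p))"
      using p s r by (simp add: outer mem_Times_iff)
    also have "\<dots> = 2 * c ?f1 p + 2 * c ?f2 p"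
      using p s r less A_sym B_sym by (auto simp: c_def)
    finally show ?thesis .
  qed
  have v: "dim_vec ?v = (n - 2)\<^sup>2" "\<And>p. p \<in> ?P \<Longrightarrow> ?v $ small.pos p = 2 * c ?f1 p + 2 * c ?f2 p"
    using C small.pos_less small.pos_div small.pos_mod C_entry
    by (auto simp: vectorize_def power2_eq_square)
  have D: "diag_of_vec ?v \<in> carrier_mat ((n - 2)\<^sup>2) ((n - 2)\<^sup>2)"
    using v(1) by (auto simp: diag_of_vec_def mk_diagonal_dim)
  have K: "?K \<in> carrier_mat ((n - 2)\<^sup>2) ((n - 2)\<^sup>2)" using subB subA by (rule small.kron_carrier)
  have K_entry: "?K $$ (small.pos q, small.pos p) = c p q" if "p \<in> ?P" "q \<in> ?P" for p q
    using that A B less unfolding small.kron_entry[OF subB subA that(2,1)]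
    by (auto simp: c_def \<epsilon>_def \<rho>_def submatrix_index_card)
  have "mat_trace ((?K + diag_of_vec ?v) * Y) =
      (\<Sum>p\<in>?P. \<Sum>q\<in>?P. (?K + diag_of_vec ?v) $$ (small.pos q, small.pos p) * y p q)"
    using K D by (intro small.trace_mult) simp
  also have "\<dots> = (\<Sum>p\<in>?P. \<Sum>q\<in>?P. c p q * y p q +
      (if q = p then (2 * c ?f1 p + 2 * c ?f2 p) * y p q else 0))"
  proof (intro sum.cong refl)
    fix p q assume pq: "p \<in> ?P" "q \<in> ?P"
    have "(?K + diag_of_vec ?v) $$ (small.pos q, small.pos p) =
        c p q + (if q = p then 2 * c ?f1 p + 2 * c ?f2 p else 0)"
      using K D pq v small.pos_less by (simp add: K_entry index_diag_of_vec small.pos_eq_iff)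
    then show "(?K + diag_of_vec ?v) $$ (small.pos q, small.pos p) * y p q =
        c p q * y p q + (if q = p then (2 * c ?f1 p + 2 * c ?f2 p) * y p q else 0)"
      by (simp add: algebra_simps)
  qed
  also have "\<dots> = (\<Sum>p\<in>?P. \<Sum>q\<in>?P. c p q * y p q) + (\<Sum>p\<in>?P. (2 * c ?f1 p + 2 * c ?f2 p) * y p p)"
    using finP by (simp add: sum.distrib sum.delta)
  finally have "mat_trace ((B \<otimes>\<^sub>m A) * Z) = mat_trace ((?K + diag_of_vec ?v) * Y) + fix_d A B s1 s2 r1 r2"
    using big_trace by simp
  moreover have "Z \<in> qap_feasible n" using ker_z big.qap_feasible_iff by simp
  ultimately show thesis using that by blast
qed

theorem MC_QAP_le_MC_fix_pair:
  assumes "A \<in> carrier_mat n n" "transpose_mat A = A"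
    and "B \<in> carrier_mat n n" "transpose_mat B = B"
    and "s1 < n" "s2 < n" "s1 \<noteq> s2" and "r1 < n" "r2 < n" "r1 \<noteq> r2"
  shows "MC_QAP n A B \<le> MC_fix_pair n A B s1 s2 r1 r2"
  unfolding MC_fix_pair_def Let_def
proof (rule INF_greatest)
  fix Y assume "Y \<in> qap_feasible (n - 2)"
  from fix_pair_feasible[OF assms this] obtain Z where "Z \<in> qap_feasible n"
    and "mat_trace ((B \<otimes>\<^sub>m A) * Z) =
      mat_trace ((submatrix B ({0..<n} - {s1, s2}) ({0..<n} - {s1, s2}) \<otimes>\<^sub>m
          submatrix A ({0..<n} - {r1, r2}) ({0..<n} - {r1, r2}) +
        diag_of_vec (vectorize (fix_C n A B s1 s2 r1 r2))) * Y) + fix_d A B s1 s2 r1 r2"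
    by blast
  then show "MC_QAP n A B \<le> ereal (1/2 * mat_trace
      ((submatrix B ({0..<n} - {s1, s2}) ({0..<n} - {s1, s2}) \<otimes>\<^sub>m
          submatrix A ({0..<n} - {r1, r2}) ({0..<n} - {r1, r2}) +
        diag_of_vec (vectorize (fix_C n A B s1 s2 r1 r2))) * Y) + 1/2 * fix_d A B s1 s2 r1 r2)"
    unfolding MC_QAP_def by (intro INF_lower2[of Z]) (simp_all add: algebra_simps)
qed

section \<open>Orbitals and the minimum\<close>

lemma orbital_pair:
  assumes "U \<in> orbitals G" "(u, v) \<in> U"
  shows "u \<in> pverts G" "v \<in> pverts G" "u \<noteq> v"
proof -
  obtain a b p where ab: "a \<in> pverts G" "b \<in> pverts G" "a \<noteq> b"
    and p: "p permutes pverts G" and uv: "u = p a" "v = p b"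
    using assms by (auto simp: orbitals_def orbits_def orbit_def aut_group_def)
  then show "u \<in> pverts G" "v \<in> pverts G" "u \<noteq> v"
    using permutes_in_image[OF p] permutes_inj[OF p] by (auto dest: injD)
qed


text \<open>The minimum in \<^const>\<open>MC_fix\<close> is a proper minimum only over a nonempty set of orbitals; the
  endpoints of the chosen edge of the cut graph supply the two vertices.\<close>
lemma orbitals_nonempty:
  assumes "a \<in> pverts G" "b \<in> pverts G" "a \<noteq> b"
  shows "orbitals G \<noteq> {}"
  using assms by (auto simp: orbitals_def orbits_def)

theorem corollary1:
  fixes n m1 m2 m3 s1 s2 t :: nat
    and G :: "nat pair_pre_digraph"
    and A B :: "real mat"
    and Orb :: "nat \<Rightarrow> (nat \<times> nat) set"
    and r1 r2 :: "nat \<Rightarrow> nat"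
  assumes "m1 \<ge> 1" and "m2 \<ge> 1" and "m1 + m2 + m3 = n"
    and "pair_graph G" and "pverts G = {0..<n}"
    and "A = adj_mat n G"
    and "B = cut_mat m1 m2 m3"
    and "bij_betw Orb {1..t} (orbitals G)"
    and "(s1, s2) \<in> parcs (cut_graph m1 m2 m3)"
    and "\<forall>h \<in> {1..t}. (r1 h, r2 h) \<in> Orb h"
  shows "MC_fix n A B s1 s2 t r1 r2 \<ge> MC_QAP n A B"
proof -
  have adj_sym: "transpose_mat (adj_mat n H) = adj_mat n H" if "pair_graph H" for H
  proof -
    interpret pair_graph H by (rule that)
    have "(i, j) \<in> parcs H \<longleftrightarrow> (j, i) \<in> parcs H" for i j
      using arcs_symmetric by auto
    then show ?thesis by (intro eq_matI) (auto simp: adj_mat_def)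
  qed
  have A: "A \<in> carrier_mat n n" "transpose_mat A = A"
    using assms(6) adj_sym[OF assms(4)] by (auto simp: adj_mat_def)
  have "B = adj_mat n (cut_graph m1 m2 m3)"
    using assms(3,7) adj_mat_cut_graph[of m1 m2 m3] by simp
  then have B: "B \<in> carrier_mat n n" "transpose_mat B = B"
    using adj_sym[OF pair_graph_cut_graph] by (auto simp: adj_mat_def)
  have s: "s1 < n" "s2 < n" "s1 \<noteq> s2"
    using assms(3,9) by (auto simp: cut_graph_def index_cut_mat split: if_splits)
  have Orb: "Orb ` {1..t} = orbitals G" using assms(8) by (simp add: bij_betw_def)
  have "orbitals G \<noteq> {}"
    using s assms(5) by (intro orbitals_nonempty[of s1 _ s2]) auto
  then have t: "{1..t} \<noteq> {}" using Orb by auto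
  have "MC_QAP n A B \<le> MC_fix_pair n A B s1 s2 (r1 h) (r2 h)" if h: "h \<in> {1..t}" for h
  proof -
    have "Orb h \<in> orbitals G" "(r1 h, r2 h) \<in> Orb h" using h Orb assms(10) by auto
    from orbital_pair[OF this] have "r1 h < n" "r2 h < n" "r1 h \<noteq> r2 h" using assms(5) by auto
    then show ?thesis using A B s by (intro MC_QAP_le_MC_fix_pair)
  qed
  then show ?thesis unfolding MC_fix_def using t by (subst Min_ge_iff) auto
qed

end
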